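(* Let $\mu$ be a sampling-based inventory-agnostic policy, and let $j\in\mathcal J$ and $t\in\mathcal T$. For each $i\in\mathcal N$ let $$H^-_{it}(\mu)=\mathbb P\Big\{\sum_{k\in\mathcal T\setminus\{t\}}B^\mu_{ik}\le c_i-1\Big\}.$$ Then any optimal solution of the static assortment optimization problem $$\max_{S\subseteq\mathcal N}\ \sum_{i\in\mathcal N}r_i\,H^-_{it}(\mu)\,\phi_{ij}(S)$$ is an optimal solution of the problem $\max_{S\subseteq\mathcal N}\mathrm{rev}(M_{jt}(\mu,S))$.
   Context: Model. Products $\mathcal N=\{1,\dots,n\}$; product $i$ has revenue $r_i\ge 0$ and initial inventory $c_i\in\mathbb Z_+$. Customer types $\mathcal J=\{1,\dots,m\}$; time periods $\mathcal T=\{1,\dots,T\}$. At each period $t$ exactly one customer arrives, of type $j$ with probability $\lambda_{jt}\ge0$, $\sum_{j\in\mathcal J}\lambda_{jt}=1$; arrivals and choices at different periods are independent. If assortment $S\subseteq\mathcal N$ is offered to a type-$j$ customer, she chooses product $i$ with probability $\phi_{ij}(S)\ge0$ and chooses nothing with probability $1-\sum_{i\in\mathcal N}\phi_{ij}(S)\ge 0$; $\phi_{ij}(S)=0$ for $i\notin S$. Substitutability: $\phi_{ij}(S\cup\{\ell\})\le\phi_{ij}(S)$ for all $i\in S$, $\ell\notin S$, $j\in\mathcal J$, $S\subseteq\mathcal N$. Policies. A sampling-based inventory-agnostic policy $\mu$ is given by mutually independent random assortments $(S^\mu_{jt}: j\in\mathcal J, t\in\mathcal T)$, independent of arrivals and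 choices; if a type-$j$ customer arrives at period $t$, the assortment $S^\mu_{jt}$ is offered regardless of remaining inventories. If the customer chooses a product with no remaining inventory she leaves without a purchase; otherwise, if she chooses product $i$, one unit of its inventory is consumed and revenue $r_i$ is collected. $\mathrm{rev}(\mu)$ is the total expected revenue of $\mu$ over the selling horizon. Explicitly, with $\varphi^\mu_{it}=\sum_{j}\lambda_{jt}\sum_{S}\mathbb P\{S^\mu_{jt}=S\}\phi_{ij}(S)$ and, for each $i$, independent Bernoulli random variables $B^\mu_{it}$ ($t\in\mathcal T$) with parameters $\varphi^\mu_{it}$ (the demand for product $i$ at period $t$), $\mathrm{rev}(\mu)=\sum_{i}r_i\,\mathbb E\{\min\{c_i,\sum_{t\in\mathcal T}B^\mu_{it}\}\}$. $M_{jt}(\mu,S)$ denotes the policy obtained from $\mu$ by replacing the random assortment $S^\mu_{jt}$ with the deterministic assortment $S$, keeping all else unchanged. *)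

theory Defs
  imports "HOL-Probability.Probability"
begin

record rm_instance =
  num_products :: nat
  num_types :: nat
  horizon :: nat
  revenue :: "nat \<Rightarrow> real"
  capacity :: "nat \<Rightarrow> nat"
  arrival_prob :: "nat \<Rightarrow> nat \<Rightarrow> real"  (* type, period *)
  choice_prob :: "nat \<Rightarrow> nat \<Rightarrow> nat set \<Rightarrow> real"  (* product, type, assortment *)

definition products :: "rm_instance \<Rightarrow> nat set" where
  "products X = {1..num_products X}"

definition customer_types :: "rm_instance \<Rightarrow> nat set" where
  "customer_types X = {1..num_types X}"

definition periods :: "rm_instance \<Rightarrow> nat set" where
  "periods X = {1..horizon X}"

definition arrival_model :: "rm_instance \<Rightarrow> bool" where
  "arrival_model X \<longleftrightarrow>
     (\<forall>t\<in>periods X. (\<forall>j\<in>customer_types X. 0 \<le> arrival_prob X j t) \<and>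
        (\<Sum>j\<in>customer_types X. arrival_prob X j t) = 1)"

definition choice_model :: "rm_instance \<Rightarrow> bool" where
  "choice_model X \<longleftrightarrow>
     (\<forall>j\<in>customer_types X. \<forall>S. S \<subseteq> products X \<longrightarrow>
        (\<forall>i\<in>products X. 0 \<le> choice_prob X i j S) \<and>
        (\<Sum>i\<in>products X. choice_prob X i j S) \<le> 1 \<and>
        (\<forall>i\<in>products X - S. choice_prob X i j S = 0))"

definition substitutable :: "rm_instance \<Rightarrow> bool" where
  "substitutable X \<longleftrightarrow>
     (\<forall>j\<in>customer_types X. \<forall>S. S \<subseteq> products X \<longrightarrow>
        (\<forall>i\<in>S. \<forall>l\<in>products X - S.
           choice_prob X i j (S \<union> {l}) \<le> choice_prob X i j S))"

definition valid_instance :: "rm_instance \<Rightarrow> bool" where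
  "valid_instance X \<longleftrightarrow>
     (\<forall>i\<in>products X. 0 \<le> revenue X i) \<and>
     arrival_model X \<and> choice_model X \<and> substitutable X"

text \<open>
  The random assortments of a sampling-based policy are mutually independent and independent of
  everything else, so a policy is given by the law of the assortment for each type and period.
\<close>

type_synonym policy = "nat \<Rightarrow> nat \<Rightarrow> nat set pmf"

definition sampling_policy :: "rm_instance \<Rightarrow> policy \<Rightarrow> bool" where
  "sampling_policy X \<mu> \<longleftrightarrow>
     (\<forall>j\<in>customer_types X. \<forall>t\<in>periods X. set_pmf (\<mu> j t) \<subseteq> Pow (products X))"

definition replace_assortment :: "nat \<Rightarrow> nat \<Rightarrow> policy \<Rightarrow> nat set \<Rightarrow> policy" where
  "replace_assortment j t \<mu> S = \<mu>(j := (\<mu> j)(t := return_pmf S))"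

definition arrival_law :: "rm_instance \<Rightarrow> nat \<Rightarrow> nat pmf" where
  "arrival_law X t = embed_pmf (\<lambda>j. if j \<in> customer_types X then arrival_prob X j t else 0)"

definition choice_law :: "rm_instance \<Rightarrow> nat \<Rightarrow> nat set \<Rightarrow> nat option pmf" where
  "choice_law X j S = embed_pmf (\<lambda>x. case x of
       None \<Rightarrow> 1 - (\<Sum>i\<in>products X. choice_prob X i j S)
     | Some i \<Rightarrow> if i \<in> products X then choice_prob X i j S else 0)"

text \<open>
  Law of the sequence of choices. The last arguments of \<open>Pi_pmf\<close> are the marginals of independent
  components, the middle ones are only values outside the index set.
\<close>

definition choice_path :: "rm_instance \<Rightarrow> policy \<Rightarrow> (nat \<Rightarrow> nat option) pmf" where
  "choice_path X \<mu> = do {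
     A \<leftarrow> Pi_pmf (customer_types X \<times> periods X) {} (\<lambda>(j, t). \<mu> j t);
     a \<leftarrow> Pi_pmf (periods X) 0 (arrival_law X);
     Pi_pmf (periods X) None (\<lambda>t. choice_law X (a t) (A (a t, t)))
   }"

text \<open>
  Remaining inventories after a number of periods. A customer who chooses a sold-out product
  consumes nothing: subtraction on naturals truncates at zero.
\<close>

primrec inventory :: "rm_instance \<Rightarrow> (nat \<Rightarrow> nat option) \<Rightarrow> nat \<Rightarrow> nat \<Rightarrow> nat" where
  "inventory X \<omega> 0 = capacity X"
| "inventory X \<omega> (Suc t) =
     (\<lambda>i. inventory X \<omega> t i - (if \<omega> (Suc t) = Some i then 1 else 0))"

definition period_revenue :: "rm_instance \<Rightarrow> (nat \<Rightarrow> nat option) \<Rightarrow> nat \<Rightarrow> real" where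
  "period_revenue X \<omega> t = (case \<omega> t of
       None \<Rightarrow> 0
     | Some i \<Rightarrow> if inventory X \<omega> (t - 1) i > 0 then revenue X i else 0)"

definition expected_revenue :: "rm_instance \<Rightarrow> policy \<Rightarrow> real" where
  "expected_revenue X \<mu> = measure_pmf.expectation (choice_path X \<mu>)
     (\<lambda>\<omega>. \<Sum>t\<in>periods X. period_revenue X \<omega> t)"

definition demand_prob :: "rm_instance \<Rightarrow> policy \<Rightarrow> nat \<Rightarrow> nat \<Rightarrow> real" where
  "demand_prob X \<mu> i t = (\<Sum>j\<in>customer_types X. arrival_prob X j t *
     (\<Sum>S\<in>Pow (products X). pmf (\<mu> j t) S * choice_prob X i j S))"

definition demand_law :: "rm_instance \<Rightarrow> policy \<Rightarrow> nat \<Rightarrow> (nat \<Rightarrow> bool) pmf" where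
  "demand_law X \<mu> i = Pi_pmf (periods X) False (\<lambda>t. bernoulli_pmf (demand_prob X \<mu> i t))"

definition H_minus :: "rm_instance \<Rightarrow> policy \<Rightarrow> nat \<Rightarrow> nat \<Rightarrow> real" where
  "H_minus X \<mu> i t = measure_pmf.prob (demand_law X \<mu> i)
     {B. (\<Sum>k\<in>periods X - {t}. of_bool (B k)) \<le> int (capacity X i) - 1}"

section \<open>The explicit formula for the expected revenue\<close>

lemma finite_index_sets [simp]:
  "finite (products X)" "finite (customer_types X)" "finite (periods X)"
  by (simp_all add: products_def customer_types_def periods_def)

lemma pmf_arrival_law:
  assumes "arrival_model X" "t \<in> periods X"
  shows "pmf (arrival_law X t) j = (if j \<in> customer_types X then arrival_prob X j t else 0)"
  unfolding arrival_law_def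
proof (rule pmf_embed_pmf)
  show "0 \<le> (if j \<in> customer_types X then arrival_prob X j t else 0)" for j
    using assms by (auto simp: arrival_model_def)
  have "(\<integral>\<^sup>+ j. ennreal (if j \<in> customer_types X then arrival_prob X j t else 0)
          \<partial>count_space UNIV) = (\<Sum>j\<in>customer_types X. ennreal (arrival_prob X j t))"
    by (subst nn_integral_count_space'[of "customer_types X"]) (auto intro!: sum.cong)
  also have "\<dots> = ennreal (\<Sum>j\<in>customer_types X. arrival_prob X j t)"
    using assms by (intro sum_ennreal) (auto simp: arrival_model_def)
  finally show "(\<integral>\<^sup>+ j. ennreal (if j \<in> customer_types X then arrival_prob X j t else 0)
          \<partial>count_space UNIV) = 1"
    using assms by (simp add: arrival_model_def)
qed

lemma pmf_choice_law:
  assumes "choice_model X" "j \<in> customer_types X" "S \<subseteq> products X"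
  shows "pmf (choice_law X j S) x = (case x of
       None \<Rightarrow> 1 - (\<Sum>i\<in>products X. choice_prob X i j S)
     | Some i \<Rightarrow> if i \<in> products X then choice_prob X i j S else 0)"
  (is "_ = ?f x")
  unfolding choice_law_def
proof (rule pmf_embed_pmf)
  show nonneg: "0 \<le> ?f x" for x
    using assms by (auto simp: choice_model_def split: option.split)
  have "(\<integral>\<^sup>+ x. ennreal (?f x) \<partial>count_space UNIV) =
          (\<Sum>x\<in>insert None (Some ` products X). ennreal (?f x))"
    by (subst nn_integral_count_space'[of "insert None (Some ` products X)"])
       (auto split: option.splits)
  also have "\<dots> = ennreal (\<Sum>x\<in>insert None (Some ` products X). ?f x)"
    using nonneg by (intro sum_ennreal) auto
  also have "(\<Sum>x\<in>insert None (Some ` products X). ?f x) = 1"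
    by (subst sum.insert) (auto simp: sum.reindex)
  finally show "(\<integral>\<^sup>+ x. ennreal (?f x) \<partial>count_space UNIV) = 1"
    by simp
qed

lemma Pi_pmf_reindex:
  assumes "finite A" "inj_on h A"
  shows "map_pmf (\<lambda>g x. if x \<in> A then g (h x) else d) (Pi_pmf (h ` A) d p) =
           Pi_pmf A d (\<lambda>x. p (h x))"
  using assms
proof (induction A rule: finite_induct)
  case (insert x A)
  have "h x \<notin> h ` A" using insert by auto
  then have "map_pmf (\<lambda>g x'. if x' \<in> insert x A then g (h x') else d)
               (Pi_pmf (h ` insert x A) d p) =
        map_pmf (\<lambda>(y, g) x'. if x' \<in> insert x A then (g(h x := y)) (h x') else d)
               (pair_pmf (p (h x)) (Pi_pmf (h ` A) d p))"
    using insert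
    by (auto simp: Pi_pmf_insert pmf.map_comp intro!: map_pmf_cong)
  also have "(\<lambda>(y, g) x'. if x' \<in> insert x A then (g(h x := y)) (h x') else d) =
        (\<lambda>(y, f). f(x := y)) \<circ> map_prod id (\<lambda>g x. if x \<in> A then g (h x) else d)"
    using insert by (auto simp: fun_eq_iff inj_on_def)
  also have "map_pmf \<dots> (pair_pmf (p (h x)) (Pi_pmf (h ` A) d p)) =
        map_pmf (\<lambda>(y, f). f(x := y)) (pair_pmf (p (h x)) (Pi_pmf A d (\<lambda>x. p (h x))))"
    using insert.IH insert.prems
    by (simp flip: pmf.map_comp apsnd_def pair_map_pmf2)
  also have "\<dots> = Pi_pmf (insert x A) d (\<lambda>x. p (h x))"
    using insert by (simp add: Pi_pmf_insert)
  finally show ?case .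
qed simp

definition period_choice :: "rm_instance \<Rightarrow> policy \<Rightarrow> nat \<Rightarrow> nat option pmf" where
  "period_choice X \<mu> t = do {j \<leftarrow> arrival_law X t; S \<leftarrow> \<mu> j t; choice_law X j S}"

lemma choice_path_eq:
  assumes "arrival_model X"
  shows "choice_path X \<mu> = Pi_pmf (periods X) None (period_choice X \<mu>)"
proof -
  let ?T = "periods X" and ?J = "customer_types X"
  have *: "Pi_pmf ?T None (\<lambda>t. bind_pmf (\<mu> (a t) t) (choice_law X (a t))) =
      bind_pmf (Pi_pmf (?J \<times> ?T) {} (\<lambda>(j, t). \<mu> j t))
        (\<lambda>A. Pi_pmf ?T None (\<lambda>t. choice_law X (a t) (A (a t, t))))"
    if "a \<in> set_pmf (Pi_pmf ?T 0 (arrival_law X))" for a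
  proof -
    let ?h = "\<lambda>t. (a t, t)"
    have "a t \<in> ?J" if "t \<in> ?T" for t
    proof -
      have "a t \<in> set_pmf (arrival_law X t)"
        using \<open>a \<in> _\<close> that by (auto simp: set_Pi_pmf PiE_dflt_def)
      then show ?thesis
        using assms that by (auto simp: set_pmf_eq pmf_arrival_law split: if_splits)
    qed
    then have sub: "?h ` ?T \<subseteq> ?J \<times> ?T" by auto
    have "Pi_pmf ?T {} (\<lambda>t. \<mu> (a t) t) =
        map_pmf (\<lambda>g t. if t \<in> ?T then g (?h t) else {})
          (Pi_pmf (?h ` ?T) {} (\<lambda>(j, t). \<mu> j t))"
      by (subst Pi_pmf_reindex) (auto simp: inj_on_def)
    also have "\<dots> = map_pmf (\<lambda>g t. if t \<in> ?T then g (?h t) else {})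
          (Pi_pmf (?J \<times> ?T) {} (\<lambda>(j, t). \<mu> j t))"
      by (subst Pi_pmf_subset[OF _ sub])
         (auto simp: pmf.map_comp o_def fun_eq_iff intro!: map_pmf_cong)
    finally have eq: "Pi_pmf ?T {} (\<lambda>t. \<mu> (a t) t) = \<dots>" .
    show ?thesis
      by (subst Pi_pmf_bind[where d' = "{}"])
         (auto simp: eq bind_map_pmf intro!: bind_pmf_cong Pi_pmf_cong)
  qed
  have "choice_path X \<mu> = bind_pmf (Pi_pmf ?T 0 (arrival_law X))
      (\<lambda>a. bind_pmf (Pi_pmf (?J \<times> ?T) {} (\<lambda>(j, t). \<mu> j t))
        (\<lambda>A. Pi_pmf ?T None (\<lambda>t. choice_law X (a t) (A (a t, t)))))"
    unfolding choice_path_def by (rule bind_commute_pmf)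
  also have "\<dots> = bind_pmf (Pi_pmf ?T 0 (arrival_law X))
      (\<lambda>a. Pi_pmf ?T None (\<lambda>t. bind_pmf (\<mu> (a t) t) (choice_law X (a t))))"
    by (intro bind_pmf_cong refl) (simp add: *)
  also have "\<dots> = Pi_pmf ?T None (period_choice X \<mu>)"
    unfolding period_choice_def by (subst Pi_pmf_bind[where d' = 0]) auto
  finally show ?thesis .
qed

lemma set_period_choice:
  assumes "arrival_model X" "choice_model X" "sampling_policy X \<mu>" "t \<in> periods X"
  shows "set_pmf (period_choice X \<mu> t) \<subseteq> insert None (Some ` products X)"
proof
  fix x assume "x \<in> set_pmf (period_choice X \<mu> t)"
  then obtain j S where *: "j \<in> set_pmf (arrival_law X t)" "S \<in> set_pmf (\<mu> j t)"
      "x \<in> set_pmf (choice_law X j S)"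
    by (auto simp: period_choice_def)
  then have j: "j \<in> customer_types X"
    using assms by (auto simp: set_pmf_eq pmf_arrival_law split: if_splits)
  then have "S \<subseteq> products X"
    using * assms by (auto simp: sampling_policy_def)
  then have "pmf (choice_law X j S) x \<noteq> 0 \<Longrightarrow> x \<in> insert None (Some ` products X)"
    using j assms by (auto simp: pmf_choice_law split: option.splits if_splits)
  then show "x \<in> insert None (Some ` products X)"
    using * by (auto simp: set_pmf_eq)
qed

lemma pmf_period_choice:
  assumes "arrival_model X" "choice_model X" "sampling_policy X \<mu>" "t \<in> periods X"
    "i \<in> products X"
  shows "pmf (period_choice X \<mu> t) (Some i) = demand_prob X \<mu> i t"
proof -
  have inner: "pmf (bind_pmf (\<mu> j t) (choice_law X j)) (Some i) =
      (\<Sum>S\<in>Pow (products X). pmf (\<mu> j t) S * choice_prob X i j S)"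
    if "j \<in> customer_types X" for j
  proof -
    have sub: "set_pmf (\<mu> j t) \<subseteq> Pow (products X)"
      using assms that by (auto simp: sampling_policy_def)
    have "pmf (bind_pmf (\<mu> j t) (choice_law X j)) (Some i) =
        (\<Sum>S\<in>Pow (products X). pmf (\<mu> j t) S * pmf (choice_law X j S) (Some i))"
      unfolding pmf_bind
      by (subst integral_measure_pmf_real[of "Pow (products X)"])
         (use sub in \<open>auto simp: mult.commute\<close>)
    also have "\<dots> = (\<Sum>S\<in>Pow (products X). pmf (\<mu> j t) S * choice_prob X i j S)"
      using assms that by (intro sum.cong) (auto simp: pmf_choice_law)
    finally show ?thesis .
  qed
  have sub: "set_pmf (arrival_law X t) \<subseteq> customer_types X"
    using assms by (auto simp: set_pmf_eq pmf_arrival_law split: if_splits)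
  have "pmf (period_choice X \<mu> t) (Some i) = (\<Sum>j\<in>customer_types X.
      pmf (arrival_law X t) j * pmf (bind_pmf (\<mu> j t) (choice_law X j)) (Some i))"
    unfolding period_choice_def pmf_bind[of "arrival_law X t"]
    by (subst integral_measure_pmf_real[of "customer_types X"])
       (use sub in \<open>auto simp: mult.commute\<close>)
  also have "\<dots> = demand_prob X \<mu> i t"
    unfolding demand_prob_def using assms
    by (intro sum.cong) (auto simp: pmf_arrival_law inner)
  finally show ?thesis .
qed

lemma demand_law_eq:
  assumes "arrival_model X" "choice_model X" "sampling_policy X \<mu>" "i \<in> products X"
  shows "demand_law X \<mu> i = map_pmf (\<lambda>\<omega> t. \<omega> t = Some i) (choice_path X \<mu>)"
proof -
  have "bernoulli_pmf (demand_prob X \<mu> i t) = map_pmf (\<lambda>x. x = Some i) (period_choice X \<mu> t)"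
    if "t \<in> periods X" for t
  proof -
    let ?p = "map_pmf (\<lambda>x. x = Some i) (period_choice X \<mu> t)"
    have "pmf ?p True = measure_pmf.prob (period_choice X \<mu> t) {Some i}"
      by (simp add: pmf_map vimage_def)
    then have True: "pmf ?p True = demand_prob X \<mu> i t"
      using pmf_period_choice[OF assms(1-3) that assms(4)] by (simp add: measure_pmf_single)
    then have "0 \<le> demand_prob X \<mu> i t" "demand_prob X \<mu> i t \<le> 1"
      using pmf_nonneg[of ?p True] pmf_le_1[of ?p True] by auto
    then show ?thesis
      using True by (intro pmf_eqI) (metis (full_types) pmf_bernoulli_True pmf_False_conv_True)
  qed
  then have "demand_law X \<mu> i =
      Pi_pmf (periods X) False (\<lambda>t. map_pmf (\<lambda>x. x = Some i) (period_choice X \<mu> t))"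
    unfolding demand_law_def by (intro Pi_pmf_cong) auto
  also have "\<dots> = map_pmf (\<lambda>h. (\<lambda>x. x = Some i) \<circ> h)
      (Pi_pmf (periods X) None (period_choice X \<mu>))"
    by (rule Pi_pmf_map) auto
  finally show ?thesis
    using assms by (simp add: choice_path_eq o_def)
qed

lemma inventory_eq:
  "inventory X \<omega> t i = capacity X i - (\<Sum>k\<in>{1..t}. of_bool (\<omega> k = Some i))"
  by (induction t) auto

lemma total_revenue_eq:
  assumes "\<And>t. t \<in> {1..n} \<Longrightarrow> \<omega> t \<in> insert None (Some ` products X)"
  shows "(\<Sum>t\<in>{1..n}. period_revenue X \<omega> t) = (\<Sum>i\<in>products X. revenue X i *
           real (min (capacity X i) (\<Sum>t\<in>{1..n}. of_bool (\<omega> t = Some i))))"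
  using assms
proof (induction n)
  case (Suc n)
  have IH: "(\<Sum>t\<in>{1..n}. period_revenue X \<omega> t) = (\<Sum>i\<in>products X. revenue X i *
           real (min (capacity X i) (\<Sum>t\<in>{1..n}. of_bool (\<omega> t = Some i))))"
    by (rule Suc.IH) (use Suc.prems in auto)
  have "period_revenue X \<omega> (Suc n) = (\<Sum>i\<in>products X. if \<omega> (Suc n) = Some i then
          if inventory X \<omega> n i > 0 then revenue X i else 0 else 0)"
    using Suc.prems[of "Suc n"] by (auto simp: period_revenue_def)
  then have "(\<Sum>t\<in>{1..Suc n}. period_revenue X \<omega> t) =
      (\<Sum>i\<in>products X. revenue X i *
          real (min (capacity X i) (\<Sum>t\<in>{1..n}. of_bool (\<omega> t = Some i))) +
        (if \<omega> (Suc n) = Some i then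
          if inventory X \<omega> n i > 0 then revenue X i else 0 else 0))"
    by (simp only: IH sum.distrib sum.cl_ivl_Suc) simp
  also have "\<dots> = (\<Sum>i\<in>products X. revenue X i *
           real (min (capacity X i) (\<Sum>t\<in>{1..Suc n}. of_bool (\<omega> t = Some i))))"
  proof (intro sum.cong refl)
    fix i
    define d :: nat where "d = (\<Sum>t\<in>{1..n}. of_bool (\<omega> t = Some i))"
    have step: "(\<Sum>t\<in>{1..Suc n}. of_bool (\<omega> t = Some i)) = d + of_bool (\<omega> (Suc n) = Some i)"
      unfolding d_def by (subst sum.cl_ivl_Suc) simp
    show "revenue X i * real (min (capacity X i) (\<Sum>t\<in>{1..n}. of_bool (\<omega> t = Some i))) +
        (if \<omega> (Suc n) = Some i then
          if inventory X \<omega> n i > 0 then revenue X i else 0 else 0) =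
      revenue X i * real (min (capacity X i) (\<Sum>t\<in>{1..Suc n}. of_bool (\<omega> t = Some i)))"
    proof -
      have "real (min (capacity X i) (d + 1)) =
          real (min (capacity X i) d) + (if capacity X i - d > 0 then 1 else 0)"
        by auto
      then show ?thesis
        by (simp only: step inventory_eq d_def[symmetric]) (simp add: distrib_left)
    qed
  qed
  finally show ?case .
qed simp

lemma expected_revenue_explicit:
  assumes "valid_instance X" "sampling_policy X \<mu>"
  shows "expected_revenue X \<mu> = (\<Sum>i\<in>products X. revenue X i *
           measure_pmf.expectation (demand_law X \<mu> i)
             (\<lambda>B. real (min (capacity X i) (\<Sum>t\<in>periods X. of_bool (B t)))))"
proof -
  have *: "arrival_model X" "choice_model X"
    using assms by (auto simp: valid_instance_def)
  let ?D = "\<lambda>i \<omega>. real (min (capacity X i) (\<Sum>t\<in>periods X. of_bool (\<omega> t = Some i)))"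
  have int: "integrable (choice_path X \<mu>) (?D i)" for i
    by (rule measure_pmf.integrable_const_bound[where B = "real (capacity X i)"]) auto
  have "expected_revenue X \<mu> = measure_pmf.expectation (choice_path X \<mu>)
          (\<lambda>\<omega>. \<Sum>i\<in>products X. revenue X i * ?D i \<omega>)"
    unfolding expected_revenue_def
  proof (rule integral_cong_AE, simp, simp, unfold AE_measure_pmf_iff, rule ballI)
    fix \<omega> assume "\<omega> \<in> set_pmf (choice_path X \<mu>)"
    then have "\<omega> t \<in> insert None (Some ` products X)" if "t \<in> periods X" for t
      using set_period_choice[OF * assms(2)] that
      by (auto simp: choice_path_eq * set_Pi_pmf PiE_dflt_def)
    then show "(\<Sum>t\<in>periods X. period_revenue X \<omega> t) =
        (\<Sum>i\<in>products X. revenue X i * ?D i \<omega>)"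
      unfolding periods_def by (intro total_revenue_eq) auto
  qed
  also have "\<dots> = (\<Sum>i\<in>products X. revenue X i *
      measure_pmf.expectation (choice_path X \<mu>) (?D i))"
    by (subst Bochner_Integration.integral_sum)
       (intro integrable_mult_right int, simp del: sum_of_bool_eq)
  also have "\<dots> = (\<Sum>i\<in>products X. revenue X i *
           measure_pmf.expectation (demand_law X \<mu> i)
             (\<lambda>B. real (min (capacity X i) (\<Sum>t\<in>periods X. of_bool (B t)))))"
    using * assms by (intro sum.cong) (simp_all add: demand_law_eq)
  finally show ?thesis .
qed

end

theory Submission
  imports Defs
begin

text \<open>
  Conditioning on the demand for a product in one period shows that its expected sales are affine
  in that period's demand probability: one more unit is sold exactly when the other periods leave
  a unit in stock, so the slope is the probability of that event. The demand probability is in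
  turn affine in the choice probability under the replaced assortment, with slope the arrival
  probability. Hence the revenue is a constant plus a nonnegative multiple of the static objective.
\<close>

text \<open>Split on the coin of \<open>t\<close>. On failure the sales come from \<open>A\<close>
  alone; on success they grow by one unit, unless \<open>A\<close> already uses up the capacity
  \<open>c\<close>, in which case the truncation absorbs it.\<close>

lemma expectation_min_bernoulli_sum_insert:
  fixes p :: "'a \<Rightarrow> real"
  assumes "finite A" "t \<notin> A" "0 \<le> p t" "p t \<le> 1"
  defines "D \<equiv> Pi_pmf A False (\<lambda>k. bernoulli_pmf (p k))"
  shows "measure_pmf.expectation (Pi_pmf (insert t A) False (\<lambda>k. bernoulli_pmf (p k)))
           (\<lambda>B. real (min c (\<Sum>k\<in>insert t A. of_bool (B k)))) =
         measure_pmf.expectation D (\<lambda>B. real (min c (\<Sum>k\<in>A. of_bool (B k)))) +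
         p t * measure_pmf.prob D {B. (\<Sum>k\<in>A. of_bool (B k)) < c}"
proof -
  \<comment> \<open>\<open>?m n\<close> is the truncated total when the coin of \<open>t\<close>
    contributes \<open>n\<close> units; only \<open>n = 0\<close> and \<open>n = 1\<close>
    occur.\<close>
  let ?m = "\<lambda>n B. real (min c (n + (\<Sum>k\<in>A. of_bool (B k))))"
  have int: "integrable D (?m n)" for n
    by (rule measure_pmf.integrable_const_bound[where B = "real c"]) auto
  \<comment> \<open>With finite supports, the expectation of the bind below becomes a two-term sum
    over the value of the coin.\<close>
  have fin: "finite (set_pmf D)"
    unfolding D_def using assms(1) by (subst set_Pi_pmf) (auto intro!: finite_PiE_dflt)
  have upd: "real (min c (\<Sum>k\<in>insert t A. of_bool ((B(t := b)) k))) = ?m (of_bool b) B" for B b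
  proof -
    have "(\<Sum>k\<in>A. of_bool ((B(t := b)) k)) = (\<Sum>k\<in>A. of_bool (B k) :: nat)"
      using assms by (intro sum.cong) auto
    then show ?thesis
      using assms by (simp del: sum_of_bool_eq)
  qed
  have one: "measure_pmf.expectation D (?m 1) = measure_pmf.expectation D (?m 0) +
      measure_pmf.prob D {B. (\<Sum>k\<in>A. of_bool (B k)) < c}"
  proof -
    have "?m 1 = (\<lambda>B. ?m 0 B + indicator {B. (\<Sum>k\<in>A. of_bool (B k)) < c} B)"
      by (auto simp: fun_eq_iff indicator_def simp del: sum_of_bool_eq)
    moreover have "measure_pmf.expectation D \<dots> = measure_pmf.expectation D (?m 0) +
        measure_pmf.prob D {B. (\<Sum>k\<in>A. of_bool (B k)) < c}"
      by (subst Bochner_Integration.integral_add[OF int])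
         (simp_all add: measure_pmf.emeasure_eq_measure del: sum_of_bool_eq)
    ultimately show ?thesis by simp
  qed
  have "measure_pmf.expectation (Pi_pmf (insert t A) False (\<lambda>k. bernoulli_pmf (p k)))
           (\<lambda>B. real (min c (\<Sum>k\<in>insert t A. of_bool (B k)))) =
        measure_pmf.expectation (bernoulli_pmf (p t) \<bind> (\<lambda>b. map_pmf (\<lambda>B. B(t := b)) D))
           (\<lambda>B. real (min c (\<Sum>k\<in>insert t A. of_bool (B k))))"
    using assms by (simp add: Pi_pmf_insert' map_pmf_def del: sum_of_bool_eq)
  also have "\<dots> = (\<Sum>b\<in>UNIV. pmf (bernoulli_pmf (p t)) b *
      measure_pmf.expectation D (?m (of_bool b)))"
    by (subst pmf_expectation_bind[where A = UNIV])
       (use fin in \<open>simp_all only: integral_map_pmf upd finite subset_UNIV set_map_pmf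
          finite_imageI real_scaleR_def\<close>)
  also have "\<dots> = p t * measure_pmf.expectation D (?m 1) +
      (1 - p t) * measure_pmf.expectation D (?m 0)"
    using assms(3,4) by (simp add: UNIV_bool del: sum_of_bool_eq)
  also have "\<dots> = measure_pmf.expectation D (?m 0) +
      p t * measure_pmf.prob D {B. (\<Sum>k\<in>A. of_bool (B k)) < c}"
    by (simp only: one) (simp add: algebra_simps)
  finally show ?thesis by simp
qed

text \<open>By \<open>pmf_period_choice\<close> the demand probability is a point mass of
  \<open>period_choice\<close>. The bounds matter because \<open>bernoulli_pmf\<close> clamps its
  parameter to the unit interval.\<close>

lemma demand_prob_bounds:
  assumes "valid_instance X" "sampling_policy X \<mu>" "t \<in> periods X" "i \<in> products X"
  shows "0 \<le> demand_prob X \<mu> i t" "demand_prob X \<mu> i t \<le> 1"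
  using assms pmf_period_choice[of X \<mu> t i, symmetric]
  by (auto simp: valid_instance_def pmf_le_1)

lemma sampling_policy_replace_assortment:
  assumes "sampling_policy X \<mu>" "S \<subseteq> products X"
  shows "sampling_policy X (replace_assortment j t \<mu> S)"
  using assms by (auto simp: sampling_policy_def replace_assortment_def)

lemma demand_prob_replace_assortment_other:
  assumes "k \<noteq> t"
  shows "demand_prob X (replace_assortment j t \<mu> S) i k = demand_prob X \<mu> i k"
  using assms by (auto simp: demand_prob_def replace_assortment_def intro!: sum.cong)

text \<open>The point mass at \<open>S\<close> collapses the inner sum for type \<open>j\<close>.
  The terms of the other types are kept apart because they do not depend on
  \<open>S\<close>.\<close>

lemma demand_prob_replace_assortment_same:
  assumes "j \<in> customer_types X" "S \<subseteq> products X"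
  shows "demand_prob X (replace_assortment j t \<mu> S) i t =
    (\<Sum>j'\<in>customer_types X - {j}. arrival_prob X j' t *
       (\<Sum>S'\<in>Pow (products X). pmf (\<mu> j' t) S' * choice_prob X i j' S')) +
    arrival_prob X j t * choice_prob X i j S"
proof -
  have "(\<Sum>S'\<in>Pow (products X). pmf (return_pmf S) S' * choice_prob X i j S') =
      (\<Sum>S'\<in>Pow (products X). if S' = S then choice_prob X i j S' else 0)"
    by (intro sum.cong) (auto simp: pmf_return)
  then have "(\<Sum>S'\<in>Pow (products X). pmf (return_pmf S) S' * choice_prob X i j S') =
      choice_prob X i j S"
    using assms by simp
  then show ?thesis
    using assms
    by (simp add: demand_prob_def replace_assortment_def sum.remove[where x = j])
qed

text \<open>The event ignores the coin of \<open>t\<close>, so that coordinate can be marginalised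
  out. The integer bound becomes a strict one on naturals; at capacity 0 both events are
  empty.\<close>

lemma H_minus_eq_prob_less:
  "H_minus X \<mu> i t = measure_pmf.prob
     (Pi_pmf (periods X - {t}) False (\<lambda>k. bernoulli_pmf (demand_prob X \<mu> i k)))
     {B. (\<Sum>k\<in>periods X - {t}. of_bool (B k)) < capacity X i}"
proof -
  \<comment> \<open>\<open>Pi_pmf_subset\<close> resets coordinates outside the smaller index set to
    \<open>False\<close>; the sum never reads them.\<close>
  have *: "(\<Sum>k\<in>periods X - {t}. of_bool (if k \<in> periods X - {t} then B k else False)) =
      (\<Sum>k\<in>periods X - {t}. of_bool (B k) :: nat)" for B
    by (intro sum.cong) auto
  have **: "(\<Sum>k\<in>periods X - {t}. of_bool (B k)) \<le> int (capacity X i) - 1 \<longleftrightarrow>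
      (\<Sum>k\<in>periods X - {t}. of_bool (B k)) < capacity X i" for B
  proof -
    have "(\<Sum>k\<in>periods X - {t}. of_bool (B k)) = int (\<Sum>k\<in>periods X - {t}. of_bool (B k))"
      by (simp del: sum_of_bool_eq)
    then show ?thesis by linarith
  qed
  show ?thesis
    unfolding H_minus_def demand_law_def **
    by (subst Pi_pmf_subset[of "periods X" "periods X - {t}"])
       (simp_all add: * vimage_def del: sum_of_bool_eq)
qed

text \<open>\<open>C\<close> is fixed before \<open>S\<close>, so one constant serves all
  assortments and cancels when they are compared.\<close>

lemma expected_revenue_replace_assortment:
  assumes "valid_instance X" "sampling_policy X \<mu>" "j \<in> customer_types X" "t \<in> periods X"
  obtains C where "\<And>S. S \<subseteq> products X \<Longrightarrow> expected_revenue X (replace_assortment j t \<mu> S) =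
    C + arrival_prob X j t * (\<Sum>i\<in>products X. revenue X i * H_minus X \<mu> i t * choice_prob X i j S)"
proof -
  \<comment> \<open>\<open>q i\<close> is the demand for \<open>i\<close> in period \<open>t\<close>
    from types other than \<open>j\<close>; \<open>E i\<close> below is the expected sales of
    \<open>i\<close> with period \<open>t\<close> left out.\<close>
  define q where "q i = (\<Sum>j'\<in>customer_types X - {j}. arrival_prob X j' t *
       (\<Sum>S'\<in>Pow (products X). pmf (\<mu> j' t) S' * choice_prob X i j' S'))" for i
  let ?A = "periods X - {t}"
  let ?D = "\<lambda>\<mu> i. Pi_pmf ?A False (\<lambda>k. bernoulli_pmf (demand_prob X \<mu> i k))"
  define E where "E i = measure_pmf.expectation (?D \<mu> i)
      (\<lambda>B. real (min (capacity X i) (\<Sum>k\<in>?A. of_bool (B k))))" for i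
  have "expected_revenue X (replace_assortment j t \<mu> S) =
      (\<Sum>i\<in>products X. revenue X i * (E i + q i * H_minus X \<mu> i t)) +
      arrival_prob X j t * (\<Sum>i\<in>products X. revenue X i * H_minus X \<mu> i t * choice_prob X i j S)"
    if S: "S \<subseteq> products X" for S
  proof -
    let ?\<nu> = "replace_assortment j t \<mu> S"
    have \<nu>: "sampling_policy X ?\<nu>"
      using assms S by (intro sampling_policy_replace_assortment)
    \<comment> \<open>Other periods keep their demand laws, so \<open>E\<close> and
      \<open>H_minus\<close> taken under \<open>\<mu>\<close> also serve the modified
      policy.\<close>
    have D: "?D ?\<nu> i = ?D \<mu> i" for i
      by (intro Pi_pmf_cong) (auto simp: demand_prob_replace_assortment_other)
    have "measure_pmf.expectation (demand_law X ?\<nu> i)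
        (\<lambda>B. real (min (capacity X i) (\<Sum>k\<in>periods X. of_bool (B k)))) =
        E i + (q i + arrival_prob X j t * choice_prob X i j S) * H_minus X \<mu> i t"
      if "i \<in> products X" for i
      using expectation_min_bernoulli_sum_insert[of ?A t "demand_prob X ?\<nu> i" "capacity X i"]
        demand_prob_bounds[OF assms(1) \<nu> assms(4) that] assms(3,4) S
      by (simp add: D H_minus_eq_prob_less E_def demand_law_def insert_absorb q_def
            demand_prob_replace_assortment_same del: sum_of_bool_eq)
    then have "expected_revenue X ?\<nu> = (\<Sum>i\<in>products X. revenue X i *
        (E i + (q i + arrival_prob X j t * choice_prob X i j S) * H_minus X \<mu> i t))"
      by (simp add: expected_revenue_explicit[OF assms(1) \<nu>] del: sum_of_bool_eq)
    then show ?thesis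
      by (simp add: sum_distrib_left sum.distrib[symmetric] algebra_simps)
  qed
  then show ?thesis by (rule that)
qed

theorem mainTheorem5:
  fixes X :: rm_instance and \<mu> :: policy and j t :: nat and S :: "nat set"
  assumes "valid_instance X"
    and "sampling_policy X \<mu>"
    and "j \<in> customer_types X" and "t \<in> periods X"
    and "is_arg_max (\<lambda>S. \<Sum>i\<in>products X. revenue X i * H_minus X \<mu> i t * choice_prob X i j S)
           (\<lambda>S. S \<subseteq> products X) S"
  shows "is_arg_max (\<lambda>S. expected_revenue X (replace_assortment j t \<mu> S)) (\<lambda>S. S \<subseteq> products X) S"
proof -
  obtain C where C: "\<And>S. S \<subseteq> products X \<Longrightarrow> expected_revenue X (replace_assortment j t \<mu> S) =
    C + arrival_prob X j t * (\<Sum>i\<in>products X. revenue X i * H_minus X \<mu> i t * choice_prob X i j S)"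
    using expected_revenue_replace_assortment[OF assms(1-4)] by blast
  \<comment> \<open>A nonnegative factor preserves weak inequalities, hence maximisers; if it is 0,
    all assortments tie in revenue.\<close>
  have "0 \<le> arrival_prob X j t"
    using assms(1,3,4) by (auto simp: valid_instance_def arrival_model_def)
  then show ?thesis
    using assms(5) by (simp add: is_arg_max_linorder C mult_left_mono)
qed

end
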